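(* Let $t\ge 1$ be an integer and let $k=4t$. Then the following assertion is false: "for all sufficiently large $n$, every Gallai-3-coloring of $K_n$ contains a $k$-connected subgraph of order at least $n-\left\lfloor\frac{k-1}{2}\right\rfloor$ using at most two colors." That is, for every $n_0$ there are $n\ge n_0$ and a Gallai-3-coloring of $K_n$ that contains no $4t$-connected subgraph of order at least $n-\left\lfloor\frac{4t-1}{2}\right\rfloor$ using at most two colors.
   Context: A Gallai-3-coloring of $K_n$ is an edge-coloring of $K_n$ with three colors, all three of which appear, containing no rainbow triangle (a triangle whose three edges have pairwise different colors). The order of a graph is its number of vertices. A subgraph uses at most two colors if its edges receive at most two colors in total. *)

theory Defs
  imports Main "HOL-Library.Ramsey"
begin

text \<open>A graph is given by a vertex set \<open>V\<close> and a set \<open>E\<close> of two-element subsets of \<open>V\<close>;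
  \<open>K\<^sub>n\<close> has the vertex set \<open>{..<n}\<close> and the edge set \<open>nsets {..<n} 2\<close>.\<close>

definition simple_graph :: "'a set \<Rightarrow> 'a set set \<Rightarrow> bool" where
  "simple_graph V E \<longleftrightarrow> finite V \<and> E \<subseteq> nsets V 2"

definition is_subgraph :: "'a set \<Rightarrow> 'a set set \<Rightarrow> 'a set \<Rightarrow> 'a set set \<Rightarrow> bool" where
  "is_subgraph W F V E \<longleftrightarrow> simple_graph W F \<and> W \<subseteq> V \<and> F \<subseteq> E"

definition connected_graph :: "'a set \<Rightarrow> 'a set set \<Rightarrow> bool" where
  "connected_graph V E \<longleftrightarrow> (\<forall>x\<in>V. \<forall>y\<in>V. (x, y) \<in> {(u, v). {u, v} \<in> E}\<^sup>*)"

definition k_connected :: "nat \<Rightarrow> 'a set \<Rightarrow> 'a set set \<Rightarrow> bool" where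
  "k_connected k V E \<longleftrightarrow> k < card V \<and>
     (\<forall>S. S \<subseteq> V \<and> card S < k \<longrightarrow> connected_graph (V - S) {e \<in> E. e \<inter> S = {}})"

definition rainbow_triangle :: "('a set \<Rightarrow> nat) \<Rightarrow> 'a \<Rightarrow> 'a \<Rightarrow> 'a \<Rightarrow> bool" where
  "rainbow_triangle c x y z \<longleftrightarrow> x \<noteq> y \<and> y \<noteq> z \<and> x \<noteq> z \<and>
     c {x, y} \<noteq> c {y, z} \<and> c {y, z} \<noteq> c {x, z} \<and> c {x, y} \<noteq> c {x, z}"

text \<open>Only the values of \<open>c\<close> on the edges of \<open>K\<^sub>n\<close> matter. The equality of the image with the set
  of colors says both that no other color is used and that all three colors appear.\<close>

definition gallai_3_coloring :: "nat \<Rightarrow> (nat set \<Rightarrow> nat) \<Rightarrow> bool" where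
  "gallai_3_coloring n c \<longleftrightarrow> c ` nsets {..<n} 2 = {1, 2, 3} \<and>
     \<not> (\<exists>x\<in>{..<n}. \<exists>y\<in>{..<n}. \<exists>z\<in>{..<n}. rainbow_triangle c x y z)"

end

theory Submission
  imports Defs
begin

text \<open>
  The obstruction is the minimum degree: a \<open>k\<close>-connected graph has no vertex of degree below \<open>k\<close>.
  A subgraph using at most two colors avoids some color \<open>i\<close>, so it suffices to color \<open>K\<^sub>n\<close> in such a
  way that, for every color \<open>i\<close>, there is a set \<open>A\<^sub>i\<close> of \<open>2t\<close> vertices each having fewer than \<open>4t\<close>
  incident edges of color other than \<open>i\<close>. A \<open>4t\<close>-connected subgraph avoiding color \<open>i\<close> then misses
  all of \<open>A\<^sub>i\<close>, which leaves at most \<open>n - 2t\<close> vertices, one too few, as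
  \<open>\<lfloor>(4t-1)/2\<rfloor> = 2t - 1\<close>.

  The three sets are disjoint. Ideally every edge at \<open>A\<^sub>i\<close> would have color \<open>i\<close>; the only conflicts
  are the edges between different sets. All edges meeting \<open>A\<^sub>3\<close> get color 3, so a vertex of
  \<open>A\<^sub>3\<close> has no edges of another color, and a vertex of \<open>A\<^sub>1\<close> or \<open>A\<^sub>2\<close> has \<open>2t\<close>
  edges of color 3. If one of the two sets also won all edges between \<open>A\<^sub>1\<close> and \<open>A\<^sub>2\<close>, each vertex of
  the other would have \<open>4t\<close> edges of a wrong color, exactly one too many. Giving color 1
  to a perfect matching between \<open>A\<^sub>1\<close> and \<open>A\<^sub>2\<close> and color 2 to the other edges between them brings
  the number down to \<open>2t + (2t - 1)\<close> in \<open>A\<^sub>1\<close> and to \<open>2t + 1\<close> in \<open>A\<^sub>2\<close>, both below \<open>4t\<close>.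

  There is no rainbow triangle, because a triangle meeting \<open>A\<^sub>3\<close> has two edges of color 3 and every
  other triangle has only the colors 1 and 2.
\<close>

text \<open>Deleting the neighbors of \<open>a\<close> isolates \<open>a\<close>; if there are fewer than \<open>k\<close> of them, another
  vertex remains, since the graph has more than \<open>k\<close> vertices.\<close>

lemma k_connected_imp_degree_ge:
  assumes "simple_graph V E" "k_connected k V E" "a \<in> V"
  shows "k \<le> card {y. {a, y} \<in> E}"
proof (rule ccontr)
  let ?S = "{y. {a, y} \<in> E}"
  assume "\<not> k \<le> card ?S"
  then have small: "card ?S < k" by simp
  have E: "E \<subseteq> nsets V 2" and "finite V"
    using assms(1) by (auto simp: simple_graph_def)
  have sub: "?S \<subseteq> V" using E by (auto simp: nsets_def)
  have "{a, a} \<notin> E" using E by (auto simp: nsets_def)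
  then have a: "a \<in> V - ?S" using assms(3) by simp
  have "card V > k" and conn: "connected_graph (V - ?S) {e \<in> E. e \<inter> ?S = {}}"
    using assms(2) small sub by (auto simp: k_connected_def)
  have "card (V - ?S) = card V - card ?S"
    using sub \<open>finite V\<close> by (meson card_Diff_subset finite_subset)
  with small \<open>card V > k\<close> have "card (V - ?S) > 1" by linarith
  then have "V - ?S \<noteq> {a}" by (metis card_1_singleton_iff less_irrefl One_nat_def)
  then obtain b where b: "b \<in> V - ?S" "b \<noteq> a" using a by blast
  from conn a b have "(a, b) \<in> {(u, v). {u, v} \<in> {e \<in> E. e \<inter> ?S = {}}}\<^sup>*"
    by (simp add: connected_graph_def)
  then show False
    by (cases rule: converse_rtranclE) (use b in auto)
qed

text \<open>Here \<open>m = 2t\<close>, and \<open>A\<^sub>3\<close>, \<open>A\<^sub>1\<close>, \<open>A\<^sub>2\<close> are the first three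
  blocks of \<open>m\<close> vertices. The matched edges must be taken from \<open>A\<^sub>1\<close> upwards only: were \<open>x\<close> allowed
  in \<open>A\<^sub>2\<close> as well, its vertices would get a second edge of color 1, too many for \<open>m = 2\<close>.
  Color 1 on the edges outside the three blocks is an arbitrary choice.\<close>

definition matching_coloring :: "nat \<Rightarrow> nat set \<Rightarrow> nat" where
  "matching_coloring m e =
     (if e \<inter> {..<m} \<noteq> {} then 3
      else if e \<inter> {2*m..<3*m} = {} \<or> (\<exists>x\<in>{m..<2*m}. e = {x, x + m}) then 1 else 2)"

lemma matching_coloring_no_rainbow: "\<not> rainbow_triangle (matching_coloring m) x y z"
proof
  assume "rainbow_triangle (matching_coloring m) x y z"
  then have ne: "matching_coloring m {x, y} \<noteq> matching_coloring m {y, z}"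
    "matching_coloring m {y, z} \<noteq> matching_coloring m {x, z}"
    "matching_coloring m {x, y} \<noteq> matching_coloring m {x, z}"
    by (auto simp: rainbow_triangle_def)
  have three: "matching_coloring m {u, v} = 3" if "u < m \<or> v < m" for u v
    using that by (auto simp: matching_coloring_def)
  have two: "matching_coloring m {u, v} \<in> {1, 2}" if "\<not> u < m" "\<not> v < m" for u v
    using that by (simp add: matching_coloring_def)
  show False
  proof (cases "x < m \<or> y < m \<or> z < m")
    case True
    then show False using ne by (auto simp: three)
  next
    case False
    then show False using ne two[of x y] two[of y z] two[of x z] by auto
  qed
qed

lemma gallai_matching_coloring:
  assumes "m \<ge> 2" "n \<ge> 3 * m"
  shows "gallai_3_coloring n (matching_coloring m)"
proof -
  have edge: "{u, v} \<in> nsets {..<n} 2" if "u < v" "v < n" for u v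
    using that by (auto simp: nsets_def)
  have "1 = matching_coloring m {m, 2*m}" "2 = matching_coloring m {m, 2*m + 1}"
    "3 = matching_coloring m {0, m}"
    using assms by (auto simp: matching_coloring_def doubleton_eq_iff)
  moreover have "{m, 2*m} \<in> nsets {..<n} 2" "{m, 2*m + 1} \<in> nsets {..<n} 2"
    "{0, m} \<in> nsets {..<n} 2"
    by (rule edge; use assms in linarith)+
  ultimately have "{1, 2, 3} \<subseteq> matching_coloring m ` nsets {..<n} 2"
    unfolding insert_subset by (intro conjI empty_subsetI image_eqI)
  moreover have "matching_coloring m ` nsets {..<n} 2 \<subseteq> {1, 2, 3}"
    by (auto simp: matching_coloring_def)
  ultimately show ?thesis
    using matching_coloring_no_rainbow by (auto simp: gallai_3_coloring_def)
qed

text \<open>Reducing \<open>i\<close> modulo 3 puts \<open>A\<^sub>3\<close> first, so the interval is \<open>A\<^sub>i\<close>. The bound is tight for \<open>i = 1\<close>: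
  \<open>m\<close> edges of color 3 and \<open>m - 1\<close> unmatched edges to \<open>A\<^sub>2\<close>. For \<open>i = 2\<close> it needs
  \<open>m + 1 < 2m\<close>, that is \<open>m \<ge> 2\<close>.\<close>

lemma matching_coloring_few_other_edges:
  assumes "m \<ge> 2" "i \<in> {1, 2, 3}" "a \<in> {(i mod 3) * m..<(i mod 3) * m + m}"
  shows "finite {y. y \<noteq> a \<and> matching_coloring m {a, y} \<noteq> i}"
    and "card {y. y \<noteq> a \<and> matching_coloring m {a, y} \<noteq> i} < 2 * m"
proof -
  let ?N = "{y. y \<noteq> a \<and> matching_coloring m {a, y} \<noteq> i}"
  have "\<exists>M. finite M \<and> ?N \<subseteq> M \<and> card M < 2 * m"
  proof -
    consider "i = 1" "a \<in> {m..<2*m}" | "i = 2" "a \<in> {2*m..<3*m}" | "i = 3" "a < m"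
      using assms(2,3) by auto
    then show ?thesis
    proof cases
      case 1
      let ?M = "{..<m} \<union> ({2*m..<3*m} - {a + m})"
      have "?N \<subseteq> ?M"
        using 1 by (auto simp: matching_coloring_def split: if_splits)
      moreover have "card ?M < 2 * m"
        using card_Un_le[of "{..<m}" "{2*m..<3*m} - {a + m}"] 1 assms(1) by simp
      moreover have "finite ?M" by simp
      ultimately show ?thesis by (intro exI[of _ ?M] conjI)
    next
      case 2
      let ?M = "{..<m} \<union> {a - m}"
      have "?N \<subseteq> ?M"
        using 2 by (auto simp: matching_coloring_def doubleton_eq_iff split: if_splits)
      moreover have "card ?M < 2 * m"
        using card_Un_le[of "{..<m}" "{a - m}"] assms(1) by simp
      moreover have "finite ?M" by simp
      ultimately show ?thesis by (intro exI[of _ ?M] conjI)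
    next
      case 3
      then have "?N \<subseteq> {}"
        by (auto simp: matching_coloring_def)
      then show ?thesis using assms(1) by (intro exI[of _ "{}"]) simp
    qed
  qed
  then obtain M where M: "finite M" "?N \<subseteq> M" "card M < 2 * m" by blast
  show "finite ?N" using M(2,1) by (rule finite_subset)
  show "card ?N < 2 * m" using card_mono[OF M(1,2)] M(3) by (rule le_less_trans)
qed

theorem mainTheorem6:
  fixes t k :: nat
  assumes "t \<ge> 1" and "k = 4 * t"
  shows "\<not> (\<exists>n0. \<forall>n\<ge>n0. \<forall>c. gallai_3_coloring n c \<longrightarrow>
           (\<exists>V E. is_subgraph V E {..<n} (nsets {..<n} 2) \<and> k_connected k V E \<and>
                  card V \<ge> n - (k - 1) div 2 \<and> card (c ` E) \<le> 2))"
proof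
  assume "\<exists>n0. \<forall>n\<ge>n0. \<forall>c. gallai_3_coloring n c \<longrightarrow>
           (\<exists>V E. is_subgraph V E {..<n} (nsets {..<n} 2) \<and> k_connected k V E \<and>
                  card V \<ge> n - (k - 1) div 2 \<and> card (c ` E) \<le> 2)"
  then obtain n0 where n0: "\<And>n c. n \<ge> n0 \<Longrightarrow> gallai_3_coloring n c \<Longrightarrow>
           \<exists>V E. is_subgraph V E {..<n} (nsets {..<n} 2) \<and> k_connected k V E \<and>
                  card V \<ge> n - (k - 1) div 2 \<and> card (c ` E) \<le> 2"
    by blast
  define m where "m = 2 * t"
  define n where "n = max n0 (3 * m)"
  have m: "m \<ge> 2" and n: "n \<ge> 3 * m" "n \<ge> n0" and k: "k = 2 * m" "(k - 1) div 2 = m - 1"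
    using assms by (auto simp: m_def n_def)
  obtain V E where sub: "is_subgraph V E {..<n} (nsets {..<n} 2)" and conn: "k_connected k V E"
    and large: "card V \<ge> n - (m - 1)" and colors: "card (matching_coloring m ` E) \<le> 2"
    using n0[OF n(2) gallai_matching_coloring[OF m n(1)]] k by auto
  have graph: "simple_graph V E" and V: "V \<subseteq> {..<n}"
    using sub by (auto simp: is_subgraph_def)
  then have E: "E \<subseteq> nsets V 2" and "finite V"
    by (auto simp: simple_graph_def)
  have "finite (matching_coloring m ` E)"
    by (rule finite_subset[of _ "{1, 2, 3}"]) (auto simp: matching_coloring_def)
  then have "\<not> {1, 2, 3} \<subseteq> matching_coloring m ` E"
    using colors card_mono[of "matching_coloring m ` E" "{1, 2, 3}"] by auto
  then obtain i where i: "i \<in> {1, 2, 3}" "i \<notin> matching_coloring m ` E" by blast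
  let ?A = "{(i mod 3) * m..<(i mod 3) * m + m}"
  have "V \<inter> ?A = {}"
  proof (rule ccontr)
    assume "V \<inter> ?A \<noteq> {}"
    then obtain a where a: "a \<in> V" "a \<in> ?A" by blast
    note few = matching_coloring_few_other_edges[OF m i(1) a(2)]
    have "{y. {a, y} \<in> E} \<subseteq> {y. y \<noteq> a \<and> matching_coloring m {a, y} \<noteq> i}"
      using E i(2) by (auto simp: nsets_def)
    then have "card {y. {a, y} \<in> E} < k"
      unfolding k(1) by (rule le_less_trans[OF card_mono[OF few(1)] few(2)])
    then show False
      using k_connected_imp_degree_ge[OF graph conn a(1)] by simp
  qed
  moreover have "?A \<subseteq> {..<n}" using i(1) n(1) by auto
  ultimately have "card V \<le> card ({..<n} - ?A)"
    using V by (intro card_mono) auto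
  also have "\<dots> = n - m"
    using \<open>?A \<subseteq> {..<n}\<close> by (simp add: card_Diff_subset)
  finally show False using large m n(1) by linarith
qed

end
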